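(* Let $M\in M_n(\mathbb{K})$ be a non-nilpotent matrix, with the notation of the context, and let $N(M)$ be its nilpotent part. Then the matrices $N_1(M),\dots,N_r(M)$ are in $M_n(\mathbb{K}^\dag)$ and are uniquely determined in $M_n(\overline{\mathbb{K}})$ by the conditions: a) $N(M)=N_1(M)+\cdots+N_r(M)$; b) $N_h(M)S_l(M)=0$ as soon as $h\ne l$ (for $1\le h\le r$, $1\le l\le r'$); c) for every $h=1,\dots,r'$ there is a matrix $W_h\in M_n(\overline{\mathbb{K}})$ such that $N_h(M)=W_hM^{\eta_r}$. (That is, $N_1(M),\dots,N_r(M)$ satisfy (a), (b), (c), and they are the only $r$-tuple of matrices in $M_n(\overline{\mathbb{K}})$ satisfying them.)
   Context: $\mathbb{K}$ is an arbitrary field, $\overline{\mathbb{K}}$ its algebraic closure. A square matrix is semisimple if it is diagonalizable over $\overline{\mathbb{K}}$. Let $m(X)=m_1(X)^{\mu_1}\cdots m_r(X)^{\mu_r}$ be the minimal polynomial of $M$ over $\mathbb{K}$, with $\mu_i>0$ and $m_1,\dots,m_r$ mutually distinct (monic) irreducible polynomials in $\mathbb{K}[X]$. If $0$ is an eigenvalue of $M$, the factors are ordered so that $m_r(X)=X$. Put $r'=r$ if $M$ is nonsingular and $r'=r-1$ otherwise (so $r'\ge1$ since $M$ is not nilpotent). $\mathbb{F}\subseteq\overline{\mathbb{K}}$ is the splitting field of $m(X)$ over $\mathbb{K}$, and $\mathbb{K}^\dag$ is the fixed field of the group $Aut(\mathbb{F}/\mathbb{K})$ of automorphisms of $\mathbb{F}$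 fixing $\mathbb{K}$ elementwise. For each $i$, $\lambda_{i1},\dots,\lambda_{i\rho_i}$ are the distinct roots of $m_i(X)$ in $\mathbb{F}$. One has $m(X)=\prod_{i=1}^r\prod_{j=1}^{\rho_i}(X-\lambda_{ij})^{\eta_i}$ for suitable integers $\eta_i\ge\mu_i$ (independent of $j$). Put $G_{ij}(X)=m(X)/(X-\lambda_{ij})^{\eta_i}$. There is a unique family of polynomials $B_{ij}(X)\in\mathbb{K}(\lambda_{i1},\dots,\lambda_{i\rho_i})[X]$ with $\deg B_{ij}<\eta_i$ and $\sum_{i=1}^r\sum_{j=1}^{\rho_i}B_{ij}(X)G_{ij}(X)=1$; put $C_{ij}(X)=B_{ij}(X)G_{ij}(X)$. The semisimple part of $M$ is $S(M)=\sum_{i=1}^r\sum_{j=1}^{\rho_i}\lambda_{ij}C_{ij}(M)$ and the nilpotent part is $N(M)=M-S(M)$ (the unique commuting semisimple and nilpotent matrices over $\overline{\mathbb{K}}$ with sum $M$). Define $$S_i(X)=\sum_{j=1}^{\rho_i}\lambda_{ij}C_{ij}(X)\ (1\le i\le r'),\qquad N_i(X)=\sum_{j=1}^{\rho_i}(X-\lambda_{ij})C_{ij}(X)\ (1\le i\le r),$$ and let $S_i(M)$, $N_i(M)$ be the corresponding matrices. *)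

theory Defs
  imports
    "HOL-Analysis.Determinants"
    "HOL-Algebra.Generated_Fields"
    "HOL-Algebra.Algebraic_Closure_Type"
begin

text \<open>Square matrices of size n over a field are elements of type
  \<open>'a^'n^'n\<close>, with \<open>n = CARD('n)\<close>. The algebraic closure of the field \<open>'k\<close> is
  \<open>'k alg_closure\<close>, with embedding \<^const>\<open>to_ac\<close>.\<close>

definition mat_pow :: "'a::field^'n^'n \<Rightarrow> nat \<Rightarrow> 'a^'n^'n" where
  "mat_pow A k = (((**) A) ^^ k) (mat 1)"

definition nilpotent_mat :: "'a::field^'n^'n \<Rightarrow> bool" where
  "nilpotent_mat A \<longleftrightarrow> (\<exists>k. mat_pow A k = 0)"

definition mat_eigenvalue :: "'a::field^'n^'n \<Rightarrow> 'a \<Rightarrow> bool" where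
  "mat_eigenvalue A c \<longleftrightarrow> (\<exists>v. v \<noteq> 0 \<and> A *v v = c *s v)"

text \<open>Evaluation of a polynomial at a matrix; \<open>mat c\<close> is the scalar matrix with diagonal entry \<open>c\<close>.\<close>

definition poly_mat :: "'a::field poly \<Rightarrow> 'a^'n^'n \<Rightarrow> 'a^'n^'n" where
  "poly_mat p A = (\<Sum>k\<le>Polynomial.degree p. mat (Polynomial.coeff p k) ** mat_pow A k)"

definition is_min_poly :: "'a::field^'n^'n \<Rightarrow> 'a poly \<Rightarrow> bool" where
  "is_min_poly A p \<longleftrightarrow>
     Polynomial.lead_coeff p = 1 \<and> poly_mat p A = 0 \<and>
     (\<forall>q. q \<noteq> 0 \<and> poly_mat q A = 0 \<longrightarrow> Polynomial.degree p \<le> Polynomial.degree q)"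

text \<open>Subfields of the algebraic closure of \<open>'k\<close> are represented by their underlying sets.
  \<open>adjoin T\<close> is the field generated by \<open>T\<close> over the (embedded) base field.\<close>

definition adjoin :: "'k::field alg_closure set \<Rightarrow> 'k alg_closure set" where
  "adjoin T = generate_field ring_of_type_algebra (range to_ac \<union> T)"

definition splitting_field :: "'k::field poly \<Rightarrow> 'k alg_closure set" where
  "splitting_field p = adjoin {x. poly (map_poly to_ac p) x = 0}"

definition field_auts :: "'k::field alg_closure set \<Rightarrow> ('k alg_closure \<Rightarrow> 'k alg_closure) set" where
  "field_auts L =
     {\<sigma> \<in> ring_iso (ring_of_type_algebra\<lparr>carrier := L\<rparr>) (ring_of_type_algebra\<lparr>carrier := L\<rparr>).
        \<forall>a. \<sigma> (to_ac a) = to_ac a}"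

definition fixed_field :: "'k::field alg_closure set \<Rightarrow> 'k alg_closure set" where
  "fixed_field L = {x \<in> L. \<forall>\<sigma> \<in> field_auts L. \<sigma> x = x}"

text \<open>In the following definitions, \<open>m\<close> is the minimal polynomial viewed over the algebraic
  closure, \<open>lam i j\<close> (for \<open>1 \<le> j \<le> \<rho> i\<close>) are the roots of its \<open>i\<close>-th irreducible factor and
  \<open>\<eta> i\<close> is their common multiplicity as roots of \<open>m\<close>. The division in \<open>G_poly\<close> is exact
  in this situation.\<close>

definition G_poly ::
  "'a::field poly \<Rightarrow> (nat \<Rightarrow> nat \<Rightarrow> 'a) \<Rightarrow> (nat \<Rightarrow> nat) \<Rightarrow> nat \<Rightarrow> nat \<Rightarrow> 'a poly" where
  "G_poly m lam \<eta> i j = m div [:- lam i j, 1:] ^ \<eta> i"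

definition C_poly ::
  "'a::field poly \<Rightarrow> (nat \<Rightarrow> nat \<Rightarrow> 'a) \<Rightarrow> (nat \<Rightarrow> nat) \<Rightarrow> (nat \<Rightarrow> nat \<Rightarrow> 'a poly)
     \<Rightarrow> nat \<Rightarrow> nat \<Rightarrow> 'a poly" where
  "C_poly m lam \<eta> B i j = B i j * G_poly m lam \<eta> i j"

definition S_poly ::
  "'a::field poly \<Rightarrow> (nat \<Rightarrow> nat) \<Rightarrow> (nat \<Rightarrow> nat \<Rightarrow> 'a) \<Rightarrow> (nat \<Rightarrow> nat)
     \<Rightarrow> (nat \<Rightarrow> nat \<Rightarrow> 'a poly) \<Rightarrow> nat \<Rightarrow> 'a poly" where
  "S_poly m \<rho> lam \<eta> B i = (\<Sum>j=1..\<rho> i. Polynomial.smult (lam i j) (C_poly m lam \<eta> B i j))"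

definition N_poly ::
  "'a::field poly \<Rightarrow> (nat \<Rightarrow> nat) \<Rightarrow> (nat \<Rightarrow> nat \<Rightarrow> 'a) \<Rightarrow> (nat \<Rightarrow> nat)
     \<Rightarrow> (nat \<Rightarrow> nat \<Rightarrow> 'a poly) \<Rightarrow> nat \<Rightarrow> 'a poly" where
  "N_poly m \<rho> lam \<eta> B i = (\<Sum>j=1..\<rho> i. [:- lam i j, 1:] * C_poly m lam \<eta> B i j)"

definition semisimple_part ::
  "'a::field poly \<Rightarrow> nat \<Rightarrow> (nat \<Rightarrow> nat) \<Rightarrow> (nat \<Rightarrow> nat \<Rightarrow> 'a) \<Rightarrow> (nat \<Rightarrow> nat)
     \<Rightarrow> (nat \<Rightarrow> nat \<Rightarrow> 'a poly) \<Rightarrow> 'a^'n^'n \<Rightarrow> 'a^'n^'n" where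
  "semisimple_part m r \<rho> lam \<eta> B A =
     (\<Sum>i=1..r. \<Sum>j=1..\<rho> i. mat (lam i j) ** poly_mat (C_poly m lam \<eta> B i j) A)"

definition nilpotent_part ::
  "'a::field poly \<Rightarrow> nat \<Rightarrow> (nat \<Rightarrow> nat) \<Rightarrow> (nat \<Rightarrow> nat \<Rightarrow> 'a) \<Rightarrow> (nat \<Rightarrow> nat)
     \<Rightarrow> (nat \<Rightarrow> nat \<Rightarrow> 'a poly) \<Rightarrow> 'a^'n^'n \<Rightarrow> 'a^'n^'n" where
  "nilpotent_part m r \<rho> lam \<eta> B A = A - semisimple_part m r \<rho> lam \<eta> B A"

end

theory Submission
  imports Defs
begin

text \<open>
  The matrices \<open>C\<^sub>i\<^sub>j(M)\<close> are the spectral projections of \<open>M\<close>: since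
  \<open>(X - \<lambda>\<^sub>i\<^sub>j)\<close> to the power \<open>\<eta>\<^sub>i\<close> divides every \<open>G\<^sub>k\<^sub>l\<close> other than \<open>G\<^sub>i\<^sub>j\<close>, the minimal polynomial
  divides \<open>C\<^sub>i\<^sub>j C\<^sub>k\<^sub>l\<close> for distinct index pairs, and together with \<open>\<Sum> C\<^sub>i\<^sub>j = 1\<close> this makes them orthogonal
  idempotents with sum \<open>1\<close> (\<open>C_orthogonal\<close>, \<open>C_idempotent\<close>). Write \<open>E\<^sub>i\<close> for the sum of the
  \<open>C\<^sub>i\<^sub>j(M)\<close> over \<open>j\<close>, the projection that belongs to the \<open>i\<close>-th irreducible factor.

  Characterization. Suppose that \<open>A\<^sub>1, \<dots>, A\<^sub>r\<close> satisfy (a), (b) and (c). For \<open>l \<le> r'\<close> the roots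
  \<open>\<lambda>\<^sub>l\<^sub>j\<close> are nonzero and \<open>S\<^sub>l(M)\<close> acts as the scalar \<open>\<lambda>\<^sub>l\<^sub>j\<close> on the image of \<open>C\<^sub>l\<^sub>j(M)\<close>, so
  \<open>A\<^sub>h S\<^sub>l(M) = 0\<close> implies \<open>A\<^sub>h E\<^sub>l = 0\<close>. The factor \<open>X\<close>, present when \<open>M\<close> is singular, is invisible to
  the \<open>S\<^sub>l(M)\<close>; there (c) takes over, because the power of \<open>M\<close> in (c) kills \<open>E\<^sub>r\<close>. Hence
  \<open>A\<^sub>h E\<^sub>l = 0\<close> for all \<open>l \<noteq> h\<close>, and (a) forces \<open>A\<^sub>h = A\<^sub>h E\<^sub>h = N(M) E\<^sub>h\<close>
  (\<open>summand_determined_by_blocks\<close>). The matrices \<open>N\<^sub>h(M)\<close> satisfy the same conditions, so they are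
  equal to \<open>N(M) E\<^sub>h\<close> as well (\<open>N_poly_characterization\<close>).

  Rationality. An automorphism \<open>\<sigma>\<close> of the splitting field over the base field permutes the roots of
  each irreducible factor. Applied to the coefficients of the Bezout identity \<open>\<Sum> B\<^sub>i\<^sub>j G\<^sub>i\<^sub>j = 1\<close> it gives
  the same identity with the roots permuted, and the coefficients of such an identity are unique
  under the degree bound (\<open>bezout_coefficients_unique\<close>). So \<open>\<sigma>\<close> permutes the \<open>C\<^sub>i\<^sub>j\<close> for each fixed \<open>i\<close> in the
  way it permutes the roots, and the symmetric expression \<open>N\<^sub>i\<close> has \<open>\<sigma>\<close>-invariant coefficients
  (\<open>N_poly_invariant\<close>).
\<close>

section \<open>Polynomials evaluated at a matrix\<close>

lemma mat_pow_0 [simp]: "mat_pow A 0 = mat 1"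
  by (simp add: mat_pow_def)

lemma mat_pow_Suc [simp]: "mat_pow A (Suc k) = A ** mat_pow A k"
  by (simp add: mat_pow_def)

lemma mat_matrix_mult_nth: "(mat c ** A) $ i $ j = c * (A $ i $ j)"
  for A :: "'a::field^'n^'n"
  by (simp add: matrix_matrix_mult_def mat_def if_distrib[of "\<lambda>x. x * _"] cong: if_cong)

lemma matrix_mult_mat_nth: "(A ** mat c) $ i $ j = c * (A $ i $ j)"
  for A :: "'a::field^'n^'n"
  by (simp add: matrix_matrix_mult_def mat_def if_distrib[of "\<lambda>x. _ * x"] mult.commute cong: if_cong)

lemma matrix_add_rdistrib: "(A + C) ** D = A ** D + C ** D"
  for A :: "'a::field^'n^'m"
  by (simp add: vec_eq_iff matrix_matrix_mult_def sum.distrib algebra_simps)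

lemma mat_commute: "A ** mat c = mat c ** A"
  for A :: "'a::field^'n^'n"
  by (simp add: vec_eq_iff mat_matrix_mult_nth matrix_mult_mat_nth)

lemma mat_add: "mat (a + b) = mat a + mat b"
  for a :: "'a::field"
  by (simp add: vec_eq_iff mat_def)

lemma mat_mult: "mat (a * b) = mat a ** mat b"
  for a :: "'a::field"
  by (simp add: vec_eq_iff mat_matrix_mult_nth) (simp add: mat_def)

lemma matrix_mult_sum_left: "(\<Sum>i\<in>I. F i) ** Y = (\<Sum>i\<in>I. F i ** Y)"
  for Y :: "'a::field^'n^'n"
  by (induction I rule: infinite_finite_induct) (auto simp: matrix_add_rdistrib)

lemma matrix_mult_sum_right: "Y ** (\<Sum>i\<in>I. F i) = (\<Sum>i\<in>I. Y ** F i)"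
  for Y :: "'a::field^'n^'m"
  by (induction I rule: infinite_finite_induct) (auto simp: matrix_add_ldistrib)

lemma poly_mat_upper_bound:
  assumes "Polynomial.degree p \<le> n"
  shows "poly_mat p A = (\<Sum>k\<le>n. mat (Polynomial.coeff p k) ** mat_pow A k)"
  unfolding poly_mat_def
  by (rule sum.mono_neutral_left) (use assms in \<open>auto simp: Polynomial.coeff_eq_0\<close>)

lemma poly_mat_0 [simp]: "poly_mat 0 A = 0"
  by (simp add: poly_mat_def)

lemma poly_mat_pCons: "poly_mat (pCons c p) A = mat c + A ** poly_mat p A"
proof -
  have "poly_mat (pCons c p) A
      = (\<Sum>k\<le>Suc (Polynomial.degree p). mat (Polynomial.coeff (pCons c p) k) ** mat_pow A k)"
    by (rule poly_mat_upper_bound) (rule Polynomial.degree_pCons_le)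
  also have "\<dots> = mat c + (\<Sum>k\<le>Polynomial.degree p.
      mat (Polynomial.coeff p k) ** (A ** mat_pow A k))"
    by (simp add: sum.atMost_Suc_shift del: sum.atMost_Suc)
  also have "\<dots> = mat c + A ** poly_mat p A"
    by (simp add: poly_mat_def matrix_mult_sum_right matrix_mul_assoc mat_commute)
  finally show ?thesis .
qed

lemma poly_mat_add: "poly_mat (p + q) A = poly_mat p A + poly_mat q A"
proof -
  define n where "n = max (Polynomial.degree p) (Polynomial.degree q)"
  have "Polynomial.degree (p + q) \<le> n"
    unfolding n_def by (rule Polynomial.degree_add_le_max)
  then show ?thesis
    using poly_mat_upper_bound[of p n A] poly_mat_upper_bound[of q n A]
      poly_mat_upper_bound[of "p + q" n A]
    by (simp add: n_def mat_add matrix_add_rdistrib sum.distrib)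
qed

lemma mat_left_commute: "A ** (mat c ** D) = mat c ** (A ** D)"
  for A :: "'a::field^'n^'n"
  by (simp add: matrix_mul_assoc mat_commute)

lemma poly_mat_smult: "poly_mat (Polynomial.smult c p) A = mat c ** poly_mat p A"
  by (induction p) (simp_all add: poly_mat_pCons mat_mult matrix_add_ldistrib mat_left_commute[of A c])

lemma poly_mat_mult: "poly_mat (p * q) A = poly_mat p A ** poly_mat q A"
  by (induction p)
     (auto simp: poly_mat_pCons poly_mat_add poly_mat_smult matrix_add_rdistrib matrix_mul_assoc)

lemma poly_mat_1 [simp]: "poly_mat 1 A = mat 1"
  by (simp add: one_pCons poly_mat_pCons)

lemma poly_mat_X [simp]: "poly_mat [:0, 1:] A = A"
  by (simp add: poly_mat_pCons)

lemma poly_mat_sum: "poly_mat (\<Sum>i\<in>I. f i) A = (\<Sum>i\<in>I. poly_mat (f i) A)"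
  by (induction I rule: infinite_finite_induct) (auto simp: poly_mat_add)

lemma poly_mat_X_power: "poly_mat ([:0, 1:] ^ k) A = mat_pow A k"
  by (induction k) (simp_all add: poly_mat_mult del: mult_pCons_left)

lemma poly_mat_dvd_eq_0:
  assumes "poly_mat m A = 0" "m dvd p"
  shows "poly_mat p A = 0"
  using assms by (auto simp: poly_mat_mult elim!: dvdE)

lemma poly_mat_eq_mod:
  assumes "poly_mat m A = 0" "m dvd p - q"
  shows "poly_mat p A = poly_mat q A"
proof -
  have "poly_mat ((p - q) + q) A = poly_mat (p - q) A + poly_mat q A"
    by (rule poly_mat_add)
  then show ?thesis
    using poly_mat_dvd_eq_0[OF assms] by simp
qed

lemma map_matrix_mult: "map_matrix to_ac (A ** C) = map_matrix to_ac A ** map_matrix to_ac C"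
  by (simp add: vec_eq_iff matrix_matrix_mult_def to_ac_sum)

lemma map_matrix_mat: "map_matrix to_ac (mat c) = mat (to_ac c)"
  by (simp add: vec_eq_iff mat_def)

lemma map_matrix_mat_pow: "map_matrix to_ac (mat_pow A k) = mat_pow (map_matrix to_ac A) k"
  by (induction k) (auto simp: map_matrix_mult map_matrix_mat)

lemma poly_mat_map_matrix:
  "poly_mat (map_poly to_ac p) (map_matrix to_ac A) = map_matrix to_ac (poly_mat p A)"
proof (induction p)
  case 0
  then show ?case by (simp add: vec_eq_iff)
next
  case (pCons c p)
  have "map_matrix to_ac (mat c + A ** poly_mat p A)
      = mat (to_ac c) + map_matrix to_ac A ** map_matrix to_ac (poly_mat p A)"
    unfolding map_matrix_mult[symmetric] map_matrix_mat[symmetric] by (simp add: vec_eq_iff)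
  with pCons show ?case by (simp add: map_poly_pCons poly_mat_pCons)
qed

lemma invertible_mat_pow:
  fixes A :: "'a::field^'n^'n"
  assumes "invertible A"
  shows "invertible (mat_pow A k)"
proof (induction k)
  case 0
  show ?case by (auto simp: invertible_def intro: exI[of _ "mat 1"])
next
  case (Suc k)
  then show ?case using assms by (simp add: invertible_mult)
qed

lemma invertible_map_matrix:
  assumes "invertible A"
  shows "invertible (map_matrix to_ac A)"
proof -
  obtain A' where "A ** A' = mat 1" "A' ** A = mat 1"
    using assms by (auto simp: invertible_def)
  then have "map_matrix to_ac A ** map_matrix to_ac A' = mat 1"
    "map_matrix to_ac A' ** map_matrix to_ac A = mat 1"
    by (simp_all flip: map_matrix_mult add: map_matrix_mat)
  then show ?thesis by (auto simp: invertible_def)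
qed

lemma eigenvalue_0_if_not_invertible:
  fixes A :: "'a::field^'n^'n"
  assumes "\<not> invertible A"
  shows "mat_eigenvalue A 0"
proof -
  have "\<not> (\<exists>A'. A' ** A = mat 1)"
    using assms matrix_left_right_inverse by (auto simp: invertible_def)
  then obtain v where "A *v v = 0" "v \<noteq> 0"
    by (auto simp: matrix_left_invertible_ker)
  then show ?thesis by (auto simp: mat_eigenvalue_def)
qed

text \<open>An invertible factor \<open>A\<close> could be cancelled from \<open>m(A) = 0\<close>, contradicting minimality.\<close>

lemma X_not_dvd_min_poly:
  fixes A :: "'a::field^'n^'n"
  assumes "is_min_poly A m" "invertible A"
  shows "\<not> [:0, 1:] dvd m"
proof
  assume "[:0, 1:] dvd m"
  then obtain q where m: "m = [:0, 1:] * q" by (elim dvdE)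
  obtain A' where A': "A' ** A = mat 1" using assms(2) by (auto simp: invertible_def)
  have "m \<noteq> 0" using assms(1) by (auto simp: is_min_poly_def)
  then have "q \<noteq> 0" using m by auto
  have "A ** poly_mat q A = 0"
    using assms(1) by (simp only: is_min_poly_def m poly_mat_mult poly_mat_X)
  then have "A' ** A ** poly_mat q A = 0" by (simp flip: matrix_mul_assoc)
  then have "poly_mat q A = 0" by (simp add: A')
  with assms(1) \<open>q \<noteq> 0\<close> have "Polynomial.degree m \<le> Polynomial.degree q"
    by (auto simp: is_min_poly_def)
  with m \<open>q \<noteq> 0\<close> show False by simp
qed

text \<open>Right multiplication by \<open>E h\<close> leaves \<open>A h\<close> unchanged and kills all other summands. The point is
  that the right-hand side depends on the family \<open>A\<close> only through its sum: two families with equal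
  sums and the same annihilation properties coincide.\<close>

lemma summand_determined_by_blocks:
  fixes A E :: "'i \<Rightarrow> 'a::field^'n^'n"
  assumes fin: "finite I"
    and one: "(\<Sum>l\<in>I. E l) = mat 1"
    and annih: "\<And>h l. h \<in> I \<Longrightarrow> l \<in> I \<Longrightarrow> h \<noteq> l \<Longrightarrow> A h ** E l = 0"
    and h: "h \<in> I"
  shows "A h = (\<Sum>i\<in>I. A i) ** E h"
proof -
  have "A h = A h ** (\<Sum>l\<in>I. E l)" by (simp add: one)
  also have "\<dots> = (\<Sum>l\<in>I. if l = h then A h ** E h else 0)"
    unfolding matrix_mult_sum_right using annih h by (intro sum.cong) auto
  also have "\<dots> = (\<Sum>i\<in>I. A i ** E h)"
    using annih h by (intro sum.cong) auto
  finally show ?thesis by (simp add: matrix_mult_sum_left)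
qed

section \<open>Bezout identities for products of powers of linear factors\<close>

text \<open>The identity \<open>bezout\<close> is the only source of coprimality: it makes the cofactor of
  \<open>(X - a i) ^ e i\<close> in \<open>m\<close> invertible modulo
  \<open>(X - a i) ^ e i\<close>, and thereby forces the roots with positive exponent to be distinct.\<close>

locale linear_bezout =
  fixes I :: "'i set" and a :: "'i \<Rightarrow> 'a::field" and e :: "'i \<Rightarrow> nat"
    and m :: "'a poly" and B :: "'i \<Rightarrow> 'a poly"
  assumes finite_I: "finite I"
    and m_eq: "m = (\<Prod>i\<in>I. [:- a i, 1:] ^ e i)"
    and bezout: "(\<Sum>i\<in>I. B i * (m div [:- a i, 1:] ^ e i)) = 1"
begin

definition G :: "'i \<Rightarrow> 'a poly" where "G i = m div [:- a i, 1:] ^ e i"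

text \<open>If \<open>m\<close> annihilates a matrix and \<open>e i > 0\<close>, then evaluating \<open>C i\<close> at that matrix gives the
  projection onto the generalized eigenspace of \<open>a i\<close>.\<close>

definition C :: "'i \<Rightarrow> 'a poly" where "C i = B i * G i"

lemma sum_C: "(\<Sum>i\<in>I. C i) = 1"
  using bezout by (simp add: C_def G_def)

lemma linear_power_nonzero: "[:- c, 1:] ^ k \<noteq> (0 :: 'a poly)"
  by simp

lemma m_remove: "i \<in> I \<Longrightarrow> m = [:- a i, 1:] ^ e i * (\<Prod>k\<in>I - {i}. [:- a k, 1:] ^ e k)"
  unfolding m_eq by (rule prod.remove[OF finite_I])

lemma G_eq: "i \<in> I \<Longrightarrow> G i = (\<Prod>k\<in>I - {i}. [:- a k, 1:] ^ e k)"
  unfolding G_def using m_remove[of i] linear_power_nonzero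
  by (metis nonzero_mult_div_cancel_left)

lemma linear_power_mult_G: "i \<in> I \<Longrightarrow> [:- a i, 1:] ^ e i * G i = m"
  using m_remove G_eq by metis

lemma linear_power_dvd_G: "i \<in> I \<Longrightarrow> k \<in> I \<Longrightarrow> k \<noteq> i \<Longrightarrow> [:- a i, 1:] ^ e i dvd G k"
  unfolding G_eq by (rule dvd_prodI) (auto simp: finite_I)

lemma C_orthogonal:
  assumes "i \<in> I" "k \<in> I" "i \<noteq> k"
  shows "m dvd C i * C k"
proof -
  have "[:- a i, 1:] ^ e i * G i dvd G k * G i"
    using linear_power_dvd_G assms by (intro mult_dvd_mono) auto
  then show ?thesis
    unfolding C_def linear_power_mult_G[OF assms(1)]
    by (metis dvd_mult mult.assoc mult.commute)
qed

text \<open>Multiply \<open>\<Sum> C k = 1\<close> by \<open>C i\<close>; orthogonality removes all terms but one.\<close>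

lemma C_idempotent:
  assumes "i \<in> I"
  shows "m dvd C i * C i - C i"
proof -
  have "C i = (\<Sum>k\<in>I. C i * C k)"
    by (simp flip: sum_distrib_left add: sum_C)
  also have "\<dots> = C i * C i + (\<Sum>k\<in>I - {i}. C i * C k)"
    by (rule sum.remove[OF finite_I assms])
  finally have "C i * C i - C i = - (\<Sum>k\<in>I - {i}. C i * C k)"
    by (metis add_diff_cancel_left' minus_diff_eq)
  moreover have "m dvd (\<Sum>k\<in>I - {i}. C i * C k)"
    using assms by (intro dvd_sum C_orthogonal) auto
  ultimately show ?thesis by simp
qed

text \<open>Modulo \<open>m\<close>, a combination of the idempotents is multiplied by \<open>C i\<close> by picking out its
  coefficient at \<open>i\<close>. Both \<^const>\<open>S_poly\<close> and \<^const>\<open>N_poly\<close> are such combinations.\<close>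

lemma combination_mult_C:
  assumes "J \<subseteq> I" "i \<in> I"
  shows "m dvd (\<Sum>k\<in>J. f k * C k) * C i - (if i \<in> J then f i * C i else 0)"
proof -
  have fin: "finite J" using assms(1) finite_I by (rule finite_subset)
  have "(if i \<in> J then f i * C i else 0) = (\<Sum>k\<in>J. if k = i then f k * C k else 0)"
    using fin by simp
  then have "(\<Sum>k\<in>J. f k * C k) * C i - (if i \<in> J then f i * C i else 0)
      = (\<Sum>k\<in>J. f k * (C k * C i - (if k = i then C k else 0)))"
    by (simp only: sum_distrib_right sum_subtractf[symmetric])
       (auto intro!: sum.cong simp: algebra_simps)
  also have "m dvd \<dots>"
    using assms by (intro dvd_sum dvd_mult) (auto intro: C_orthogonal C_idempotent)
  finally show ?thesis .
qed

text \<open>Modulo \<open>(X - a i) ^ e i\<close> the identity says that \<open>G i\<close> is invertible with inverse \<open>B i\<close>,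
  so two coefficient families agree there, and the degree bound leaves no other freedom.\<close>

lemma bezout_coefficients_unique:
  assumes deg: "\<And>i. i \<in> I \<Longrightarrow> Polynomial.degree (B i) < e i"
    and deg': "\<And>i. i \<in> I \<Longrightarrow> Polynomial.degree (B' i) < e i"
    and bezout': "(\<Sum>i\<in>I. B' i * G i) = 1"
    and i: "i \<in> I"
  shows "B' i = B i"
proof -
  let ?L = "[:- a i, 1:] ^ e i"
  have rest: "?L dvd 1 - D i * G i" if "(\<Sum>i\<in>I. D i * G i) = 1" for D
  proof -
    have "1 - D i * G i = (\<Sum>k\<in>I - {i}. D k * G k)"
      using that sum.remove[OF finite_I i, of "\<lambda>i. D i * G i"] by (metis add_diff_cancel_left')
    then show ?thesis
      using i by (auto intro!: dvd_sum dvd_mult linear_power_dvd_G)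
  qed
  have "?L dvd (1 - B i * G i) * B' i - (1 - B' i * G i) * B i"
    by (intro dvd_diff dvd_mult2[OF rest]) (use bezout bezout' in \<open>simp_all add: G_def\<close>)
  then have dvd: "?L dvd B' i - B i" by (simp add: algebra_simps)
  have "Polynomial.degree (B' i - B i) < e i"
    by (rule Polynomial.degree_diff_less[OF deg'[OF i] deg[OF i]])
  moreover have "Polynomial.degree ?L = e i"
    by (simp add: degree_linear_power)
  ultimately have "B' i - B i = 0"
    using dvd dvd_imp_degree_le[OF dvd] by fastforce
  then show ?thesis by simp
qed

end

section \<open>Bezout identities under partial ring endomorphisms\<close>

text \<open>An automorphism of a subfield is represented by a function on the ambient type whose values
  outside the subfield are arbitrary. Therefore the homomorphism laws hold on \<open>L\<close> only, and
  polynomials can be mapped multiplicatively only if their coefficients lie in \<open>L\<close>.\<close>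

locale subring_endomorphism =
  fixes L :: "'a::field set" and \<sigma> :: "'a \<Rightarrow> 'a"
  assumes one_mem: "1 \<in> L"
    and uminus_mem: "x \<in> L \<Longrightarrow> - x \<in> L"
    and add_mem: "x \<in> L \<Longrightarrow> y \<in> L \<Longrightarrow> x + y \<in> L"
    and mult_mem: "x \<in> L \<Longrightarrow> y \<in> L \<Longrightarrow> x * y \<in> L"
    and hom_one: "\<sigma> 1 = 1"
    and hom_add: "x \<in> L \<Longrightarrow> y \<in> L \<Longrightarrow> \<sigma> (x + y) = \<sigma> x + \<sigma> y"
    and hom_mult: "x \<in> L \<Longrightarrow> y \<in> L \<Longrightarrow> \<sigma> (x * y) = \<sigma> x * \<sigma> y"
begin

lemma zero_mem: "0 \<in> L"
  using add_mem[OF one_mem uminus_mem[OF one_mem]] by simp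

lemma hom_zero: "\<sigma> 0 = 0"
  using hom_add[OF zero_mem zero_mem] by (metis add.right_neutral add_left_cancel)

lemma hom_uminus: "x \<in> L \<Longrightarrow> \<sigma> (- x) = - \<sigma> x"
  using hom_add[of x "- x"] uminus_mem[of x] hom_zero
  by (metis add.right_inverse add_eq_0_iff)

lemma sum_mem: "(\<And>i. i \<in> J \<Longrightarrow> f i \<in> L) \<Longrightarrow> (\<Sum>i\<in>J. f i) \<in> L"
  by (induction J rule: infinite_finite_induct) (auto simp: zero_mem add_mem)

lemma hom_sum: "(\<And>i. i \<in> J \<Longrightarrow> f i \<in> L) \<Longrightarrow> \<sigma> (\<Sum>i\<in>J. f i) = (\<Sum>i\<in>J. \<sigma> (f i))"
  by (induction J rule: infinite_finite_induct) (auto simp: hom_zero hom_add sum_mem)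

definition polys_over :: "'a poly set" where
  "polys_over = {p. \<forall>k. Polynomial.coeff p k \<in> L}"

lemma polys_over_pCons_iff: "pCons c p \<in> polys_over \<longleftrightarrow> c \<in> L \<and> p \<in> polys_over"
  unfolding polys_over_def
  by (auto simp: coeff_pCons split: nat.splits)

lemma polys_over_1: "1 \<in> polys_over"
  by (auto simp: polys_over_def one_mem zero_mem Polynomial.coeff_1)

lemma polys_over_mult: "p \<in> polys_over \<Longrightarrow> q \<in> polys_over \<Longrightarrow> p * q \<in> polys_over"
  by (auto simp: polys_over_def Polynomial.coeff_mult intro!: sum_mem mult_mem)

lemma polys_over_power: "p \<in> polys_over \<Longrightarrow> p ^ n \<in> polys_over"
  by (induction n) (auto simp: polys_over_1 polys_over_mult)

lemma polys_over_prod: "(\<And>i. i \<in> J \<Longrightarrow> f i \<in> polys_over) \<Longrightarrow> (\<Prod>i\<in>J. f i) \<in> polys_over"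
  by (induction J rule: infinite_finite_induct) (auto simp: polys_over_1 polys_over_mult)

lemma polys_over_sum: "(\<And>i. i \<in> J \<Longrightarrow> f i \<in> polys_over) \<Longrightarrow> (\<Sum>i\<in>J. f i) \<in> polys_over"
  by (auto simp: polys_over_def Polynomial.coeff_sum intro!: sum_mem)

lemma polys_over_linear: "c \<in> L \<Longrightarrow> [:- c, 1:] \<in> polys_over"
  by (simp add: polys_over_pCons_iff uminus_mem one_mem) (simp add: polys_over_def zero_mem)

lemma map_poly_hom_mult:
  assumes "p \<in> polys_over" "q \<in> polys_over"
  shows "map_poly \<sigma> (p * q) = map_poly \<sigma> p * map_poly \<sigma> q"
proof (rule poly_eqI)
  fix n
  show "Polynomial.coeff (map_poly \<sigma> (p * q)) n = Polynomial.coeff (map_poly \<sigma> p * map_poly \<sigma> q) n"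
    using assms
    by (simp add: Polynomial.coeff_map_poly hom_zero Polynomial.coeff_mult hom_sum mult_mem hom_mult polys_over_def)
qed

lemma map_poly_hom_sum:
  "(\<And>i. i \<in> J \<Longrightarrow> f i \<in> polys_over) \<Longrightarrow> map_poly \<sigma> (\<Sum>i\<in>J. f i) = (\<Sum>i\<in>J. map_poly \<sigma> (f i))"
  by (rule poly_eqI)
     (simp add: Polynomial.coeff_map_poly hom_zero Polynomial.coeff_sum hom_sum polys_over_def)

lemma map_poly_hom_power: "p \<in> polys_over \<Longrightarrow> map_poly \<sigma> (p ^ n) = map_poly \<sigma> p ^ n"
  by (induction n) (auto simp: hom_one map_poly_hom_mult polys_over_power)

lemma map_poly_hom_linear: "c \<in> L \<Longrightarrow> map_poly \<sigma> [:- c, 1:] = [:- \<sigma> c, 1:]"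
  by (simp add: map_poly_pCons hom_zero hom_one hom_uminus)

lemma poly_hom:
  assumes "p \<in> polys_over" "x \<in> L"
  shows "poly p x \<in> L \<and> \<sigma> (poly p x) = poly (map_poly \<sigma> p) (\<sigma> x)"
  using assms(1)
proof (induction p)
  case 0
  then show ?case by (simp add: zero_mem hom_zero)
next
  case (pCons c p)
  with assms(2) show ?case
    by (simp add: polys_over_pCons_iff map_poly_pCons hom_zero add_mem mult_mem hom_add hom_mult)
qed

end

text \<open>Applying \<open>\<sigma>\<close> to a Bezout identity whose roots it permutes gives another Bezout identity
  for the same product; uniqueness of the coefficients identifies the two (\<open>map_poly_B\<close>). The
  permutation of the roots is recorded as a permutation \<open>\<pi>\<close> of their indices.\<close>

locale linear_bezout_endomorphism = linear_bezout I a e m B + subring_endomorphism L \<sigma>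
  for I :: "'i set" and a :: "'i \<Rightarrow> 'a::field" and e m B
    and L :: "'a set" and \<sigma> +
  fixes \<pi> :: "'i \<Rightarrow> 'i"
  assumes a_mem: "i \<in> I \<Longrightarrow> a i \<in> L"
    and B_mem: "i \<in> I \<Longrightarrow> B i \<in> polys_over"
    and deg_B: "i \<in> I \<Longrightarrow> Polynomial.degree (B i) < e i"
    and m_fixed: "map_poly \<sigma> m = m"
    and \<pi>_bij: "bij_betw \<pi> I I"
    and a_\<pi>: "i \<in> I \<Longrightarrow> a (\<pi> i) = \<sigma> (a i)"
    and e_\<pi>: "i \<in> I \<Longrightarrow> e (\<pi> i) = e i"
begin

lemma \<pi>_mem: "i \<in> I \<Longrightarrow> \<pi> i \<in> I"
  using \<pi>_bij by (auto simp: bij_betw_def)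

lemma G_mem: "i \<in> I \<Longrightarrow> G i \<in> polys_over"
  unfolding G_eq by (auto intro!: polys_over_prod polys_over_power polys_over_linear a_mem)

lemma C_mem: "i \<in> I \<Longrightarrow> C i \<in> polys_over"
  unfolding C_def by (intro polys_over_mult B_mem G_mem)

text \<open>Apply \<open>\<sigma>\<close> to \<open>m = (X - a i) ^ e i * G i\<close> and cancel the power of the linear factor.\<close>

lemma map_poly_G:
  assumes "i \<in> I"
  shows "map_poly \<sigma> (G i) = G (\<pi> i)"
proof -
  have "m = map_poly \<sigma> ([:- a i, 1:] ^ e i * G i)"
    by (simp add: linear_power_mult_G assms m_fixed)
  also have "\<dots> = [:- \<sigma> (a i), 1:] ^ e i * map_poly \<sigma> (G i)"
    by (simp add: map_poly_hom_mult map_poly_hom_power map_poly_hom_linear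
        polys_over_power polys_over_linear G_mem a_mem assms)
  finally have "m = [:- \<sigma> (a i), 1:] ^ e i * map_poly \<sigma> (G i)" .
  moreover have "[:- \<sigma> (a i), 1:] ^ e i * G (\<pi> i) = m"
    using linear_power_mult_G[OF \<pi>_mem[OF assms]] by (simp only: a_\<pi>[OF assms] e_\<pi>[OF assms])
  ultimately show ?thesis by (metis linear_power_nonzero mult_left_cancel)
qed

lemma map_poly_B:
  assumes "i \<in> I"
  shows "map_poly \<sigma> (B i) = B (\<pi> i)"
proof -
  define \<pi>' where "\<pi>' = the_inv_into I \<pi>"
  have \<pi>'_mem: "\<pi>' k \<in> I" and \<pi>\<pi>': "\<pi> (\<pi>' k) = k" if "k \<in> I" for k
    using that \<pi>_bij unfolding \<pi>'_def
    by (auto simp: bij_betw_def the_inv_into_into f_the_inv_into_f)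
  have \<pi>'\<pi>: "\<pi>' (\<pi> k) = k" if "k \<in> I" for k
    using that \<pi>_bij unfolding \<pi>'_def by (auto simp: bij_betw_def the_inv_into_f_f)
  \<comment> \<open>The transported coefficients, reindexed so that \<open>B' k\<close> belongs to \<open>G k\<close>.\<close>
  define B' where "B' k = map_poly \<sigma> (B (\<pi>' k))" for k
  have "1 = map_poly \<sigma> (\<Sum>i\<in>I. B i * G i)"
    using bezout by (simp add: hom_one flip: G_def)
  also have "\<dots> = (\<Sum>i\<in>I. map_poly \<sigma> (B i) * map_poly \<sigma> (G i))"
    by (simp add: map_poly_hom_sum map_poly_hom_mult polys_over_mult B_mem G_mem)
  also have "\<dots> = (\<Sum>i\<in>I. B' (\<pi> i) * G (\<pi> i))"
    by (intro sum.cong) (auto simp: B'_def \<pi>'\<pi> map_poly_G)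
  also have "\<dots> = (\<Sum>k\<in>I. B' k * G k)"
    by (rule sum.reindex_bij_betw[OF \<pi>_bij])
  finally have "B' (\<pi> i) = B (\<pi> i)"
  proof (intro bezout_coefficients_unique)
    show "Polynomial.degree (B' k) < e k" if "k \<in> I" for k
      using deg_B[OF \<pi>'_mem[OF that]] e_\<pi>[OF \<pi>'_mem[OF that]] that
        map_poly_degree_leq[of \<sigma> "B (\<pi>' k)"] by (simp add: B'_def \<pi>\<pi>')
  qed (auto simp: deg_B \<pi>_mem assms)
  then show ?thesis by (simp add: B'_def \<pi>'\<pi> assms)
qed

lemma map_poly_C: "i \<in> I \<Longrightarrow> map_poly \<sigma> (C i) = C (\<pi> i)"
  by (simp add: C_def map_poly_hom_mult B_mem G_mem map_poly_B map_poly_G)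

end

section \<open>Nilpotent components from a Bezout identity\<close>

text \<open>The roots are now grouped: index \<open>(i, j)\<close> stands for the \<open>j\<close>-th root of the \<open>i\<close>-th factor, and
  all roots of one factor share the exponent \<open>\<eta> i\<close>.\<close>

locale block_bezout =
  linear_bezout "SIGMA i:{1..r}. {1..\<rho> i}" "\<lambda>(i, j). lam i j" "\<lambda>(i, j). \<eta> i" m "\<lambda>(i, j). B i j"
  for r :: nat and \<rho> :: "nat \<Rightarrow> nat" and lam :: "nat \<Rightarrow> nat \<Rightarrow> 'a::field"
    and \<eta> :: "nat \<Rightarrow> nat" and m :: "'a poly" and B :: "nat \<Rightarrow> nat \<Rightarrow> 'a poly"
begin

lemma C_poly_eq: "C_poly m lam \<eta> B i j = C (i, j)"
  by (simp add: C_poly_def G_poly_def C_def G_def)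

lemma S_poly_eq:
  "S_poly m \<rho> lam \<eta> B l = (\<Sum>k\<in>Pair l ` {1..\<rho> l}. [:case k of (i, j) \<Rightarrow> lam i j:] * C k)"
  by (simp add: S_poly_def C_poly_eq sum.reindex inj_on_def)

lemma N_poly_eq:
  "N_poly m \<rho> lam \<eta> B l = (\<Sum>k\<in>Pair l ` {1..\<rho> l}. [:- (case k of (i, j) \<Rightarrow> lam i j), 1:] * C k)"
  by (simp add: N_poly_def C_poly_eq sum.reindex inj_on_def del: mult_pCons_left)

lemma S_poly_mult_C:
  assumes "l \<in> {1..r}" "j \<in> {1..\<rho> l}"
  shows "m dvd S_poly m \<rho> lam \<eta> B l * C (l, j) - Polynomial.smult (lam l j) (C (l, j))"
proof -
  have "Pair l ` {1..\<rho> l} \<subseteq> (SIGMA i:{1..r}. {1..\<rho> i})" "(l, j) \<in> (SIGMA i:{1..r}. {1..\<rho> i})"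
    using assms by auto
  from combination_mult_C[OF this, of "\<lambda>k. [:case k of (i, j) \<Rightarrow> lam i j:]"]
  show ?thesis using assms by (auto simp: S_poly_eq)
qed

lemma combination_mult_C_other_block:
  assumes "h \<in> {1..r}" "l \<in> {1..r}" "h \<noteq> l" "j \<in> {1..\<rho> l}"
  shows "m dvd (\<Sum>k\<in>Pair h ` {1..\<rho> h}. f k * C k) * C (l, j)"
proof -
  have "Pair h ` {1..\<rho> h} \<subseteq> (SIGMA i:{1..r}. {1..\<rho> i})" "(l, j) \<in> (SIGMA i:{1..r}. {1..\<rho> i})"
    using assms by auto
  moreover have "(l, j) \<notin> Pair h ` {1..\<rho> h}" using assms by auto
  ultimately show ?thesis
    using combination_mult_C[of "Pair h ` {1..\<rho> h}" "(l, j)" f] by (simp only: if_False diff_zero)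
qed

lemma sum_C_blocks: "(\<Sum>i=1..r. \<Sum>j=1..\<rho> i. C (i, j)) = 1"
  using sum_C by (subst sum.Sigma) auto

text \<open>Multiply \<open>1 = \<Sum> C (i, j)\<close> by \<open>X = (X - lam i j) + lam i j\<close> and evaluate at \<open>A\<close>.\<close>

lemma nilpotent_part_eq:
  "nilpotent_part m r \<rho> lam \<eta> B A = (\<Sum>i=1..r. poly_mat (N_poly m \<rho> lam \<eta> B i) A)"
proof -
  have "[:0, 1:] = [:0, 1:] * (\<Sum>i=1..r. \<Sum>j=1..\<rho> i. C (i, j))"
    by (simp only: sum_C_blocks mult_1_right)
  also have "\<dots> = (\<Sum>i=1..r. \<Sum>j=1..\<rho> i. [:- lam i j, 1:] * C (i, j) + Polynomial.smult (lam i j) (C (i, j)))"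
    by (simp add: sum_distrib_left)
  also have "\<dots> = (\<Sum>i=1..r. N_poly m \<rho> lam \<eta> B i)
      + (\<Sum>i=1..r. \<Sum>j=1..\<rho> i. Polynomial.smult (lam i j) (C (i, j)))"
    by (simp add: N_poly_def C_poly_eq sum.distrib del: mult_pCons_left)
  finally have "poly_mat [:0, 1:] A = poly_mat ((\<Sum>i=1..r. N_poly m \<rho> lam \<eta> B i)
      + (\<Sum>i=1..r. \<Sum>j=1..\<rho> i. Polynomial.smult (lam i j) (C (i, j)))) A"
    by (rule arg_cong)
  then have "A = (\<Sum>i=1..r. poly_mat (N_poly m \<rho> lam \<eta> B i) A) + semisimple_part m r \<rho> lam \<eta> B A"
    by (simp add: poly_mat_add poly_mat_sum poly_mat_smult semisimple_part_def C_poly_eq)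
  then show ?thesis
    unfolding nilpotent_part_def by (metis add_diff_cancel_right')
qed

text \<open>When \<open>m\<close> annihilates \<open>A\<close> and \<open>\<eta> i > 0\<close>, this is the projection onto the sum of the generalized
  eigenspaces for the roots of the \<open>i\<close>-th factor.\<close>

definition block :: "'a^'n^'n \<Rightarrow> nat \<Rightarrow> 'a^'n^'n" where
  "block A i = (\<Sum>j=1..\<rho> i. poly_mat (C (i, j)) A)"

lemma sum_block: "(\<Sum>i=1..r. block A i) = mat 1"
proof -
  have "(\<Sum>i=1..r. block A i) = poly_mat (\<Sum>i=1..r. \<Sum>j=1..\<rho> i. C (i, j)) A"
    by (simp add: block_def poly_mat_sum)
  then show ?thesis by (simp only: sum_C_blocks poly_mat_1)
qed

lemma block_annihilated_if:
  assumes "\<And>j. j \<in> {1..\<rho> l} \<Longrightarrow> D ** poly_mat (C (l, j)) A = 0"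
  shows "D ** block A l = 0"
  unfolding block_def matrix_mult_sum_right using assms by (intro sum.neutral) auto

lemma N_poly_mult_block:
  assumes "poly_mat m A = 0" "h \<in> {1..r}" "l \<in> {1..r}" "h \<noteq> l"
  shows "poly_mat (N_poly m \<rho> lam \<eta> B h) A ** block A l = 0"
proof (rule block_annihilated_if)
  fix j assume "j \<in> {1..\<rho> l}"
  then show "poly_mat (N_poly m \<rho> lam \<eta> B h) A ** poly_mat (C (l, j)) A = 0"
    unfolding poly_mat_mult[symmetric] N_poly_eq using assms
    by (intro poly_mat_dvd_eq_0[OF assms(1)] combination_mult_C_other_block)
qed

lemma N_poly_mult_S_poly:
  assumes "poly_mat m A = 0" "h \<in> {1..r}" "l \<in> {1..r}" "h \<noteq> l"
  shows "poly_mat (N_poly m \<rho> lam \<eta> B h) A ** poly_mat (S_poly m \<rho> lam \<eta> B l) A = 0"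
proof -
  have "m dvd N_poly m \<rho> lam \<eta> B h * C (l, j)" if "j \<in> {1..\<rho> l}" for j
    unfolding N_poly_eq using assms that by (intro combination_mult_C_other_block)
  then have "m dvd (\<Sum>j=1..\<rho> l. Polynomial.smult (lam l j) (N_poly m \<rho> lam \<eta> B h * C (l, j)))"
    by (intro dvd_sum dvd_smult)
  then have "m dvd N_poly m \<rho> lam \<eta> B h * S_poly m \<rho> lam \<eta> B l"
    by (simp add: S_poly_def C_poly_eq sum_distrib_left)
  then show ?thesis
    unfolding poly_mat_mult[symmetric] by (rule poly_mat_dvd_eq_0[OF assms(1)])
qed

text \<open>On the image of \<open>C (l, j)\<close> the matrix of \<^const>\<open>S_poly\<close> is multiplication by \<open>lam l j\<close>, which can
  be cancelled when it is nonzero.\<close>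

lemma block_annihilated_by_S_poly:
  fixes A D :: "'a^'n^'n"
  assumes "poly_mat m A = 0" "l \<in> {1..r}"
    and nz: "\<And>j. j \<in> {1..\<rho> l} \<Longrightarrow> lam l j \<noteq> 0"
    and D: "D ** poly_mat (S_poly m \<rho> lam \<eta> B l) A = 0"
  shows "D ** block A l = 0"
proof (rule block_annihilated_if)
  fix j assume j: "j \<in> {1..\<rho> l}"
  have "poly_mat (S_poly m \<rho> lam \<eta> B l) A ** poly_mat (C (l, j)) A = mat (lam l j) ** poly_mat (C (l, j)) A"
    unfolding poly_mat_mult[symmetric] poly_mat_smult[symmetric]
    by (rule poly_mat_eq_mod[OF assms(1) S_poly_mult_C[OF assms(2) j]])
  then have "D ** poly_mat (S_poly m \<rho> lam \<eta> B l) A ** poly_mat (C (l, j)) A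
      = D ** (mat (lam l j) ** poly_mat (C (l, j)) A)"
    by (simp only: flip: matrix_mul_assoc)
  then have "mat (lam l j) ** (D ** poly_mat (C (l, j)) A)
      = D ** poly_mat (S_poly m \<rho> lam \<eta> B l) A ** poly_mat (C (l, j)) A"
    by (simp only: mat_left_commute)
  then have "mat (lam l j) ** (D ** poly_mat (C (l, j)) A) = 0" by (simp add: D)
  then have "mat (inverse (lam l j) * lam l j) ** (D ** poly_mat (C (l, j)) A) = 0"
    by (simp add: mat_mult flip: matrix_mul_assoc)
  then show "D ** poly_mat (C (l, j)) A = 0" using nz[OF j] by simp
qed

text \<open>On the generalized eigenspace of \<open>0\<close> the matrix is nilpotent, and \<open>\<eta> l\<close> bounds the exponent:
  \<open>X ^ \<eta> l * C (l, j)\<close> is a multiple of \<open>X ^ \<eta> l * G (l, j) = m\<close>.\<close>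

lemma block_annihilated_by_power:
  assumes "poly_mat m A = 0" "l \<in> {1..r}"
    and zero: "\<And>j. j \<in> {1..\<rho> l} \<Longrightarrow> lam l j = 0"
  shows "mat_pow A (\<eta> l) ** block A l = 0"
proof (rule block_annihilated_if)
  fix j assume j: "j \<in> {1..\<rho> l}"
  have "m dvd [:0, 1:] ^ \<eta> l * C (l, j)"
  proof -
    have "[:0, 1:] ^ \<eta> l * G (l, j) = m"
      using linear_power_mult_G[of "(l, j)"] assms(2) j zero[OF j] by simp
    then have "[:0, 1:] ^ \<eta> l * C (l, j) = B l j * m"
      unfolding C_def prod.case by (metis mult.left_commute)
    then show ?thesis by simp
  qed
  then show "mat_pow A (\<eta> l) ** poly_mat (C (l, j)) A = 0"
    unfolding poly_mat_X_power[symmetric] poly_mat_mult[symmetric]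
    by (rule poly_mat_dvd_eq_0[OF assms(1)])
qed

text \<open>Every \<open>G (h, j')\<close> with \<open>h \<noteq> l\<close> contains the full power \<open>X ^ \<eta> l\<close> that the root \<open>lam l j = 0\<close>
  contributes to \<open>m\<close>.\<close>

lemma N_poly_factor_power:
  assumes "h \<in> {1..r}" "l \<in> {1..r}" "h \<noteq> l" "j \<in> {1..\<rho> l}" "lam l j = 0"
  shows "\<exists>W. poly_mat (N_poly m \<rho> lam \<eta> B h) A = W ** mat_pow A (\<eta> l)"
proof -
  have "[:0, 1:] ^ \<eta> l dvd C (h, j')" if "j' \<in> {1..\<rho> h}" for j'
    using linear_power_dvd_G[of "(l, j)" "(h, j')"] assms that unfolding C_def by auto
  then have "[:0, 1:] ^ \<eta> l dvd N_poly m \<rho> lam \<eta> B h"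
    unfolding N_poly_def C_poly_eq by (intro dvd_sum dvd_mult) auto
  then obtain Q where "N_poly m \<rho> lam \<eta> B h = Q * [:0, 1:] ^ \<eta> l"
    by (metis dvd_def mult.commute)
  then have "poly_mat (N_poly m \<rho> lam \<eta> B h) A = poly_mat Q A ** mat_pow A (\<eta> l)"
    by (simp only: poly_mat_mult poly_mat_X_power)
  then show ?thesis by blast
qed

text \<open>The two alternatives are the invertible case, where no root vanishes, and the singular case,
  where exactly the last block belongs to the eigenvalue \<open>0\<close>. For a block \<open>l \<noteq> h\<close> with nonzero roots,
  condition (b) gives \<open>A h ** block M l = 0\<close>; for the block of \<open>0\<close>, condition (c) does.\<close>

theorem N_poly_characterization:
  fixes M :: "'a^'n^'n"
  assumes annih: "poly_mat m M = 0"
    and nz: "\<And>l j. l \<in> {1..r'} \<Longrightarrow> j \<in> {1..\<rho> l} \<Longrightarrow> lam l j \<noteq> 0"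
    and cases: "(r' = r \<and> invertible M) \<or>
      (r' = r - 1 \<and> 1 \<le> r \<and> 1 \<le> \<rho> r \<and> (\<forall>j\<in>{1..\<rho> r}. lam r j = 0))"
  shows "(nilpotent_part m r \<rho> lam \<eta> B M = (\<Sum>i=1..r. A i) \<and>
      (\<forall>h\<in>{1..r}. \<forall>l\<in>{1..r'}. h \<noteq> l \<longrightarrow> A h ** poly_mat (S_poly m \<rho> lam \<eta> B l) M = 0) \<and>
      (\<forall>h\<in>{1..r'}. \<exists>W. A h = W ** mat_pow M (\<eta> r)))
    \<longleftrightarrow> (\<forall>h\<in>{1..r}. A h = poly_mat (N_poly m \<rho> lam \<eta> B h) M)"
    (is "?lhs \<longleftrightarrow> ?rhs")
proof
  assume lhs: ?lhs
  have annih_block: "A h ** block M l = 0" if hl: "h \<in> {1..r}" "l \<in> {1..r}" "h \<noteq> l" for h l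
  proof (cases "l \<in> {1..r'}")
    case True
    then have "A h ** poly_mat (S_poly m \<rho> lam \<eta> B l) M = 0" using lhs hl by blast
    then show ?thesis
      using annih hl nz[OF True] by (intro block_annihilated_by_S_poly)
  next
    case False
    with hl cases have r'_eq: "r' = r - 1" and zero_r: "\<forall>j\<in>{1..\<rho> r}. lam r j = 0" by auto
    from False hl r'_eq have l: "l = r" by auto
    with hl r'_eq have h: "h \<in> {1..r'}" by auto
    from zero_r have zero: "\<forall>j\<in>{1..\<rho> l}. lam l j = 0" unfolding l .
    from lhs h obtain W where "A h = W ** mat_pow M (\<eta> l)" unfolding l by blast
    then have "A h ** block M l = W ** (mat_pow M (\<eta> l) ** block M l)"
      by (simp add: matrix_mul_assoc)
    then show ?thesis
      using block_annihilated_by_power[OF annih hl(2)] zero by simp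
  qed
  show ?rhs
  proof
    fix h assume h: "h \<in> {1..r}"
    have "A h = (\<Sum>i=1..r. A i) ** block M h"
      by (rule summand_determined_by_blocks) (use h annih_block sum_block in auto)
    also have "\<dots> = (\<Sum>i=1..r. poly_mat (N_poly m \<rho> lam \<eta> B i) M) ** block M h"
      using lhs by (simp add: nilpotent_part_eq)
    also have "\<dots> = poly_mat (N_poly m \<rho> lam \<eta> B h) M"
      by (rule summand_determined_by_blocks[symmetric])
         (use h N_poly_mult_block[OF annih] sum_block in auto)
    finally show "A h = poly_mat (N_poly m \<rho> lam \<eta> B h) M" .
  qed
next
  assume rhs: ?rhs
  have "\<exists>W. A h = W ** mat_pow M (\<eta> r)" if h: "h \<in> {1..r'}" for h
  proof (cases "invertible M")
    case True
    then obtain P where "P ** mat_pow M (\<eta> r) = mat 1"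
      using invertible_mat_pow by (metis invertible_def)
    then have "A h = (A h ** P) ** mat_pow M (\<eta> r)"
      by (simp flip: matrix_mul_assoc)
    then show ?thesis by blast
  next
    case False
    with cases have "r' = r - 1" "1 \<le> r" "1 \<in> {1..\<rho> r}" "lam r 1 = 0" by auto
    then show ?thesis
      using N_poly_factor_power[of h r 1 M] rhs h by auto
  qed
  moreover have "r' \<le> r" using cases by auto
  ultimately show ?lhs
    using rhs N_poly_mult_S_poly[OF annih] by (auto simp: nilpotent_part_eq)
qed

text \<open>The sum over \<open>j\<close> that defines \<^const>\<open>N_poly\<close> runs over all roots of one factor. Since \<open>\<sigma>\<close>
  permutes these roots and their idempotents in the same way, it only reorders the summands.\<close>

lemma N_poly_invariant:
  assumes sub: "subring_endomorphism L \<sigma>"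
    and lam_mem: "\<And>i j. i \<in> {1..r} \<Longrightarrow> j \<in> {1..\<rho> i} \<Longrightarrow> lam i j \<in> L"
    and B_mem: "\<And>i j k. i \<in> {1..r} \<Longrightarrow> j \<in> {1..\<rho> i} \<Longrightarrow> Polynomial.coeff (B i j) k \<in> L"
    and deg_B: "\<And>i j. i \<in> {1..r} \<Longrightarrow> j \<in> {1..\<rho> i} \<Longrightarrow> Polynomial.degree (B i j) < \<eta> i"
    and m_fixed: "map_poly \<sigma> m = m"
    and permutes_roots: "\<And>i. i \<in> {1..r} \<Longrightarrow> bij_betw \<sigma> (lam i ` {1..\<rho> i}) (lam i ` {1..\<rho> i})"
    and inj_lam: "\<And>i. i \<in> {1..r} \<Longrightarrow> inj_on (lam i) {1..\<rho> i}"
    and i: "i \<in> {1..r}"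
  shows "Polynomial.coeff (N_poly m \<rho> lam \<eta> B i) k \<in> L"
    and "map_poly \<sigma> (N_poly m \<rho> lam \<eta> B i) = N_poly m \<rho> lam \<eta> B i"
proof -
  interpret S: subring_endomorphism L \<sigma> by (rule sub)
  define \<pi> where "\<pi> i = the_inv_into {1..\<rho> i} (lam i) \<circ> \<sigma> \<circ> lam i" for i
  have lam_bij: "bij_betw (lam i) {1..\<rho> i} (lam i ` {1..\<rho> i})" if "i \<in> {1..r}" for i
    using inj_lam[OF that] by (rule inj_on_imp_bij_betw)
  have \<pi>_bij: "bij_betw (\<pi> i) {1..\<rho> i} {1..\<rho> i}" if "i \<in> {1..r}" for i
    unfolding \<pi>_def using lam_bij[OF that] permutes_roots[OF that]
    by (intro bij_betw_trans[of _ _ "lam i ` {1..\<rho> i}"] bij_betw_the_inv_into)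
  have lam_\<pi>: "lam i (\<pi> i j) = \<sigma> (lam i j)" if "i \<in> {1..r}" "j \<in> {1..\<rho> i}" for i j
  proof -
    have "\<sigma> (lam i j) \<in> lam i ` {1..\<rho> i}"
      using permutes_roots[OF that(1)] that(2) by (auto simp: bij_betw_def)
    then show ?thesis
      unfolding \<pi>_def using f_the_inv_into_f[OF inj_lam[OF that(1)]] by simp
  qed
  have \<pi>_mem: "\<pi> i j \<in> {1..\<rho> i}" if "i \<in> {1..r}" "j \<in> {1..\<rho> i}" for i j
    using \<pi>_bij[OF that(1)] that(2) by (auto simp: bij_betw_def)
  interpret E: linear_bezout_endomorphism "SIGMA i:{1..r}. {1..\<rho> i}" "\<lambda>(i, j). lam i j"
    "\<lambda>(i, j). \<eta> i" m "\<lambda>(i, j). B i j" L \<sigma> "\<lambda>(i, j). (i, \<pi> i j)"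
  proof unfold_locales
    let ?\<Pi> = "\<lambda>(i, j). (i, \<pi> i j)" and ?I = "SIGMA i:{1..r}. {1..\<rho> i}"
    have "inj_on ?\<Pi> ?I"
    proof (rule inj_onI)
      fix x y assume "x \<in> ?I" "y \<in> ?I" "?\<Pi> x = ?\<Pi> y"
      then obtain i j j' where x: "x = (i, j)" and y: "y = (i, j')" and eq: "\<pi> i j = \<pi> i j'"
        and mem: "i \<in> {1..r}" "j \<in> {1..\<rho> i}" "j' \<in> {1..\<rho> i}"
        by (auto simp del: One_nat_def)
      have "inj_on (\<pi> i) {1..\<rho> i}" using \<pi>_bij[OF mem(1)] by (simp add: bij_betw_def)
      then show "x = y" using inj_onD eq mem unfolding x y by metis
    qed
    moreover have "?\<Pi> ` ?I \<subseteq> ?I" using \<pi>_mem by auto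
    ultimately show "bij_betw ?\<Pi> ?I ?I"
      using endo_inj_surj[OF finite_I] by (simp add: bij_betw_def)
  qed (use lam_mem B_mem deg_B m_fixed lam_\<pi> in \<open>auto simp: S.polys_over_def\<close>)
  have C_mem: "[:- lam i j, 1:] * C (i, j) \<in> S.polys_over" if "j \<in> {1..\<rho> i}" for j
    using that i lam_mem by (intro S.polys_over_mult S.polys_over_linear E.C_mem) auto
  have "N_poly m \<rho> lam \<eta> B i \<in> S.polys_over"
    unfolding N_poly_def C_poly_eq using C_mem by (intro S.polys_over_sum)
  then show "Polynomial.coeff (N_poly m \<rho> lam \<eta> B i) k \<in> L"
    by (simp add: S.polys_over_def)
  have "map_poly \<sigma> (N_poly m \<rho> lam \<eta> B i) = (\<Sum>j=1..\<rho> i. map_poly \<sigma> ([:- lam i j, 1:] * C (i, j)))"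
    unfolding N_poly_def C_poly_eq using C_mem by (intro S.map_poly_hom_sum)
  also have "\<dots> = (\<Sum>j=1..\<rho> i. [:- lam i (\<pi> i j), 1:] * C (i, \<pi> i j))"
  proof (rule sum.cong)
    fix j assume j: "j \<in> {1..\<rho> i}"
    have "map_poly \<sigma> ([:- lam i j, 1:] * C (i, j)) = map_poly \<sigma> [:- lam i j, 1:] * map_poly \<sigma> (C (i, j))"
      using i j lam_mem by (intro S.map_poly_hom_mult S.polys_over_linear E.C_mem) auto
    also have "\<dots> = [:- lam i (\<pi> i j), 1:] * C (i, \<pi> i j)"
      using E.map_poly_C[of "(i, j)"] S.map_poly_hom_linear[OF lam_mem[OF i j]] lam_\<pi>[OF i j] i j
      by simp
    finally show "map_poly \<sigma> ([:- lam i j, 1:] * C (i, j)) = [:- lam i (\<pi> i j), 1:] * C (i, \<pi> i j)" .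
  qed simp
  also have "\<dots> = N_poly m \<rho> lam \<eta> B i"
    unfolding N_poly_def C_poly_eq by (rule sum.reindex_bij_betw[OF \<pi>_bij[OF i]])
  finally show "map_poly \<sigma> (N_poly m \<rho> lam \<eta> B i) = N_poly m \<rho> lam \<eta> B i" .
qed

end

section \<open>Automorphisms of subfields of the algebraic closure\<close>

lemma a_inv_ring_of_type_algebra: "\<ominus>\<^bsub>ring_of_type_algebra\<^esub> x = - x"
  for x :: "'a::field"
proof -
  interpret R: Ring.field "ring_of_type_algebra :: 'a ring" by rule
  show ?thesis
    by (rule R.minus_equality) (auto simp: ring_of_type_algebra_def)
qed

lemma adjoin_base: "to_ac c \<in> adjoin T"
  unfolding adjoin_def by (rule generate_field.incl) auto

lemma adjoin_incl: "x \<in> T \<Longrightarrow> x \<in> adjoin T"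
  unfolding adjoin_def by (rule generate_field.incl) auto

lemma adjoin_uminus: "x \<in> adjoin T \<Longrightarrow> - x \<in> adjoin T"
  unfolding adjoin_def by (metis a_inv_ring_of_type_algebra generate_field.a_inv)

lemma adjoin_add: "x \<in> adjoin T \<Longrightarrow> y \<in> adjoin T \<Longrightarrow> x + y \<in> adjoin T"
  unfolding adjoin_def
  using generate_field.eng_add[of x ring_of_type_algebra _ y] by (simp add: ring_of_type_algebra_def)

lemma adjoin_mult: "x \<in> adjoin T \<Longrightarrow> y \<in> adjoin T \<Longrightarrow> x * y \<in> adjoin T"
  unfolding adjoin_def
  using generate_field.eng_mult[of x ring_of_type_algebra _ y] by (simp add: ring_of_type_algebra_def)

lemma adjoin_mono: "T \<subseteq> T' \<Longrightarrow> adjoin T \<subseteq> adjoin T'"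
proof -
  interpret R: Ring.field "ring_of_type_algebra :: 'a alg_closure ring" by rule
  assume "T \<subseteq> T'"
  then show ?thesis
    unfolding adjoin_def by (intro R.mono_generate_field) (auto simp: ring_of_type_algebra_def)
qed

text \<open>The identity serves as the trivial instance that supplies closure facts about \<open>adjoin T\<close> where
  no automorphism is given.\<close>

lemma subring_endomorphism_id: "subring_endomorphism (adjoin T) (\<lambda>x. x)"
  using adjoin_base[of 1 T]
  by unfold_locales (auto intro: adjoin_add adjoin_mult adjoin_uminus)

lemma subring_endomorphism_field_aut:
  assumes "\<sigma> \<in> field_auts (adjoin T)"
  shows "subring_endomorphism (adjoin T) \<sigma>"
proof -
  from assms have hom: "\<sigma> \<in> ring_hom (ring_of_type_algebra\<lparr>carrier := adjoin T\<rparr>)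
      (ring_of_type_algebra\<lparr>carrier := adjoin T\<rparr>)"
    by (auto simp: field_auts_def ring_iso_def)
  show ?thesis
    using adjoin_base[of 1 T] ring_hom_add[OF hom] ring_hom_mult[OF hom] ring_hom_one[OF hom]
    by unfold_locales
       (auto intro: adjoin_add adjoin_mult adjoin_uminus simp: ring_of_type_algebra_def)
qed

lemma field_aut_bij:
  assumes "\<sigma> \<in> field_auts L"
  shows "bij_betw \<sigma> L L"
  using assms by (auto simp: field_auts_def ring_iso_def)

lemma field_aut_base: "\<sigma> \<in> field_auts L \<Longrightarrow> \<sigma> (to_ac c) = to_ac c"
  by (simp add: field_auts_def)

lemma map_poly_field_aut_base:
  assumes "\<sigma> \<in> field_auts L"
  shows "map_poly \<sigma> (map_poly to_ac q) = map_poly to_ac q"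
proof (rule poly_eqI)
  have "\<sigma> 0 = 0" using field_aut_base[OF assms, of 0] by simp
  then show "Polynomial.coeff (map_poly \<sigma> (map_poly to_ac q)) k = Polynomial.coeff (map_poly to_ac q) k" for k
    by (simp add: Polynomial.coeff_map_poly field_aut_base[OF assms])
qed

text \<open>\<open>\<sigma>\<close> maps roots to roots because it fixes the coefficients of \<open>q\<close>; it is injective, and \<open>R\<close> is
  finite, so it is onto.\<close>

lemma field_aut_permutes_roots:
  assumes \<sigma>: "\<sigma> \<in> field_auts (adjoin T)" and "q \<noteq> 0"
  defines "R \<equiv> {x \<in> adjoin T. poly (map_poly to_ac q) x = 0}"
  shows "bij_betw \<sigma> R R"
proof -
  interpret S: subring_endomorphism "adjoin T" \<sigma>
    by (rule subring_endomorphism_field_aut[OF \<sigma>])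
  have q: "map_poly to_ac q \<in> S.polys_over"
    by (simp add: S.polys_over_def Polynomial.coeff_map_poly adjoin_base)
  have "map_poly to_ac q \<noteq> 0"
    using \<open>q \<noteq> 0\<close> by (subst map_poly_eq_0_iff) auto
  then have "finite R"
    unfolding R_def by (auto intro: finite_subset[OF _ poly_roots_finite])
  moreover have "\<sigma> ` R \<subseteq> R"
  proof
    fix y assume "y \<in> \<sigma> ` R"
    then obtain x where x: "x \<in> adjoin T" "poly (map_poly to_ac q) x = 0" "y = \<sigma> x"
      by (auto simp: R_def)
    have "poly (map_poly to_ac q) y = \<sigma> (poly (map_poly to_ac q) x)"
      using S.poly_hom[OF q x(1)] x(3) by (simp add: map_poly_field_aut_base[OF \<sigma>])
    moreover have "y \<in> adjoin T"
      using field_aut_bij[OF \<sigma>] x by (auto simp: bij_betw_def)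
    ultimately show "y \<in> R" using x(2) S.hom_zero by (simp add: R_def)
  qed
  moreover have "inj_on \<sigma> R"
    using field_aut_bij[OF \<sigma>] by (auto simp: bij_betw_def R_def inj_on_def)
  ultimately show ?thesis
    using endo_inj_surj by (simp add: bij_betw_def)
qed

text \<open>The powers of \<open>M\<close> have entries in the base field, so each entry of \<open>q(M)\<close> is a linear combination
  of the coefficients of \<open>q\<close> over the base field.\<close>

lemma poly_mat_entry_fixed:
  assumes mem: "\<And>k. Polynomial.coeff q k \<in> adjoin T"
    and fixed: "\<And>\<sigma>. \<sigma> \<in> field_auts (adjoin T) \<Longrightarrow> map_poly \<sigma> q = q"
  shows "poly_mat q (map_matrix to_ac M) $ a $ b \<in> fixed_field (adjoin T)"
proof -
  have entry: "poly_mat q (map_matrix to_ac M) $ a $ b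
      = (\<Sum>k\<le>Polynomial.degree q. Polynomial.coeff q k * to_ac (mat_pow M k $ a $ b))"
    by (simp add: poly_mat_def mat_matrix_mult_nth flip: map_matrix_mat_pow)
  interpret Id: subring_endomorphism "adjoin T" "\<lambda>x. x" by (rule subring_endomorphism_id)
  have "poly_mat q (map_matrix to_ac M) $ a $ b \<in> adjoin T"
    unfolding entry by (intro Id.sum_mem Id.mult_mem mem adjoin_base)
  moreover have "\<sigma> (poly_mat q (map_matrix to_ac M) $ a $ b) = poly_mat q (map_matrix to_ac M) $ a $ b"
    if \<sigma>: "\<sigma> \<in> field_auts (adjoin T)" for \<sigma>
  proof -
    interpret S: subring_endomorphism "adjoin T" \<sigma>
      by (rule subring_endomorphism_field_aut[OF \<sigma>])
    have "\<sigma> (Polynomial.coeff q k) = Polynomial.coeff q k" for k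
      using fixed[OF \<sigma>] Polynomial.coeff_map_poly[of \<sigma> q k] S.hom_zero by simp
    then show ?thesis
      unfolding entry
      by (simp add: S.hom_sum S.hom_mult S.mult_mem mem adjoin_base field_aut_base[OF \<sigma>])
  qed
  ultimately show ?thesis by (simp add: fixed_field_def)
qed

section \<open>The nilpotent components of a matrix\<close>

lemma monic_irreducible_root_0:
  fixes q :: "'a::field poly"
  assumes "Factorial_Ring.irreducible q" "Polynomial.lead_coeff q = 1" "poly q 0 = 0"
  shows "q = [:0, 1:]"
proof -
  have "[:0, 1:] dvd q" using assms(3) by (simp add: dvd_iff_poly_eq_0)
  then obtain c where c: "q = [:0, 1:] * c" by (elim dvdE)
  have "\<not> is_unit ([:0, 1:] :: 'a poly)" by (simp add: is_unit_iff_degree)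
  then have "is_unit c" using Factorial_Ring.irreducibleD[OF assms(1) c] by blast
  then obtain d where d: "c = [:d:]" by (auto simp: is_unit_poly_iff)
  with assms(2) c have "d = 1" by (simp split: if_splits)
  with c d show ?thesis by simp
qed

theorem proposition2p7:
  fixes M :: "'k::field^'n^'n"
    and m :: "'k poly" and p :: "nat \<Rightarrow> 'k poly" and \<mu> :: "nat \<Rightarrow> nat"
    and r r' :: nat
    and lam :: "nat \<Rightarrow> nat \<Rightarrow> 'k alg_closure" and \<rho> \<eta> :: "nat \<Rightarrow> nat"
    and B :: "nat \<Rightarrow> nat \<Rightarrow> 'k alg_closure poly"
    and mbar :: "'k alg_closure poly" and Mbar :: "'k alg_closure^'n^'n"
  assumes not_nilpotent: "\<not> nilpotent_mat M"
    and min_poly: "is_min_poly M m"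
    and factorization: "m = (\<Prod>i=1..r. p i ^ \<mu> i)"
    and mu_pos: "\<And>i. i \<in> {1..r} \<Longrightarrow> 0 < \<mu> i"
    and irred: "\<And>i. i \<in> {1..r} \<Longrightarrow> Factorial_Ring.irreducible (p i)"
    and monic: "\<And>i. i \<in> {1..r} \<Longrightarrow> Polynomial.lead_coeff (p i) = 1"
    and distinct_factors: "inj_on p {1..r}"
    and X_last: "mat_eigenvalue M 0 \<Longrightarrow> p r = [:0, 1:]"
    and r': "r' = (if invertible M then r else r - 1)"
    and roots: "\<And>i. i \<in> {1..r} \<Longrightarrow>
      bij_betw (lam i) {1..\<rho> i} {x \<in> splitting_field m. poly (map_poly to_ac (p i)) x = 0}"
    and mbar: "mbar = map_poly to_ac m"
    and Mbar: "Mbar = map_matrix to_ac M"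
    and eta: "mbar = (\<Prod>i=1..r. \<Prod>j=1..\<rho> i. [:- lam i j, 1:] ^ \<eta> i)"
    and B_coeffs: "\<And>i j k. i \<in> {1..r} \<Longrightarrow> j \<in> {1..\<rho> i} \<Longrightarrow>
      Polynomial.coeff (B i j) k \<in> adjoin (lam i ` {1..\<rho> i})"
    and B_degree: "\<And>i j. i \<in> {1..r} \<Longrightarrow> j \<in> {1..\<rho> i} \<Longrightarrow> Polynomial.degree (B i j) < \<eta> i"
    and B_sum: "(\<Sum>i=1..r. \<Sum>j=1..\<rho> i. B i j * G_poly mbar lam \<eta> i j) = 1"
  shows "(\<forall>i\<in>{1..r}. \<forall>a b.
           poly_mat (N_poly mbar \<rho> lam \<eta> B i) Mbar $ a $ b \<in> fixed_field (splitting_field m)) \<and>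
         (\<forall>A :: nat \<Rightarrow> 'k alg_closure^'n^'n.
           ((nilpotent_part mbar r \<rho> lam \<eta> B Mbar = (\<Sum>i=1..r. A i)) \<and>
            (\<forall>h\<in>{1..r}. \<forall>l\<in>{1..r'}. h \<noteq> l \<longrightarrow>
               A h ** poly_mat (S_poly mbar \<rho> lam \<eta> B l) Mbar = 0) \<and>
            (\<forall>h\<in>{1..r'}. \<exists>W :: 'k alg_closure^'n^'n. A h = W ** mat_pow Mbar (\<eta> r)))
           \<longleftrightarrow> (\<forall>h\<in>{1..r}. A h = poly_mat (N_poly mbar \<rho> lam \<eta> B h) Mbar))"
proof -
  interpret block_bezout r \<rho> lam \<eta> mbar B
  proof unfold_locales
    show "mbar = (\<Prod>i\<in>(SIGMA i:{1..r}. {1..\<rho> i}). [:- (case i of (i, j) \<Rightarrow> lam i j), 1:] ^ (case i of (i, j) \<Rightarrow> \<eta> i))"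
      unfolding eta by (subst prod.Sigma) (auto intro!: prod.cong)
    have "(\<Sum>k\<in>(SIGMA i:{1..r}. {1..\<rho> i}). (case k of (i, j) \<Rightarrow> B i j) *
        (mbar div [:- (case k of (i, j) \<Rightarrow> lam i j), 1:] ^ (case k of (i, j) \<Rightarrow> \<eta> i)))
      = (\<Sum>i=1..r. \<Sum>j=1..\<rho> i. B i j * G_poly mbar lam \<eta> i j)"
      by (subst sum.Sigma) (auto simp: G_poly_def intro!: sum.cong)
    then show "(\<Sum>k\<in>(SIGMA i:{1..r}. {1..\<rho> i}). (case k of (i, j) \<Rightarrow> B i j) *
        (mbar div [:- (case k of (i, j) \<Rightarrow> lam i j), 1:] ^ (case k of (i, j) \<Rightarrow> \<eta> i))) = 1"
      by (simp only: B_sum)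
  qed simp
  have annih: "poly_mat mbar Mbar = 0"
    using min_poly by (simp add: mbar Mbar poly_mat_map_matrix is_min_poly_def vec_eq_iff)
  define T where "T = {x. poly mbar x = 0}"
  have F_eq: "splitting_field m = adjoin T"
    by (simp add: splitting_field_def T_def mbar)
  have lam_image: "lam i ` {1..\<rho> i} = {x \<in> adjoin T. poly (map_poly to_ac (p i)) x = 0}"
    and lam_inj: "inj_on (lam i) {1..\<rho> i}" if "i \<in> {1..r}" for i
    using roots[OF that] by (auto simp: bij_betw_def F_eq)
  \<comment> \<open>A root equal to \<open>0\<close> can only come from the factor \<open>X\<close>, which is the last one if it occurs.\<close>
  have lam_zero: "p i = [:0, 1:]" if "i \<in> {1..r}" "j \<in> {1..\<rho> i}" "lam i j = 0" for i j
  proof -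
    have "poly (map_poly to_ac (p i)) 0 = 0"
      using lam_image[OF that(1)] that(2,3) by (metis (mono_tags, lifting) image_eqI mem_Collect_eq)
    then have "poly (p i) 0 = 0"
      by (simp add: poly_0_coeff_0 Polynomial.coeff_map_poly)
    then show ?thesis
      using irred[OF that(1)] monic[OF that(1)] by (intro monic_irreducible_root_0)
  qed
  have p_dvd: "p i dvd m" if "i \<in> {1..r}" for i
  proof -
    have "p i dvd p i ^ \<mu> i" using mu_pos[OF that] by simp
    also have "\<dots> dvd m" unfolding factorization using that by (intro dvd_prodI) auto
    finally show ?thesis .
  qed
  have lam_T: "lam i j \<in> T" if "i \<in> {1..r}" "j \<in> {1..\<rho> i}" for i j
  proof -
    have "0 < \<eta> i" using B_degree[OF that] by simp
    then have "[:- lam i j, 1:] dvd [:- lam i j, 1:] ^ \<eta> i" by simp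
    also have "\<dots> dvd mbar" using linear_power_mult_G[of "(i, j)"] that
      by (metis (no_types, lifting) SigmaI case_prod_conv dvd_triv_left)
    finally show ?thesis by (simp add: T_def poly_eq_0_iff_dvd)
  qed
  have entries: "poly_mat (N_poly mbar \<rho> lam \<eta> B i) Mbar $ a $ b \<in> fixed_field (adjoin T)"
    if i: "i \<in> {1..r}" for i a b
  proof -
    have lam_mem: "lam i j \<in> adjoin T" if "i \<in> {1..r}" "j \<in> {1..\<rho> i}" for i j
      using lam_T[OF that] by (rule adjoin_incl)
    have B_mem: "Polynomial.coeff (B i j) k \<in> adjoin T" if "i \<in> {1..r}" "j \<in> {1..\<rho> i}" for i j k
      using B_coeffs[OF that] adjoin_mono[of "lam i ` {1..\<rho> i}" T] lam_T that by blast
    have bij: "bij_betw \<sigma> (lam i ` {1..\<rho> i}) (lam i ` {1..\<rho> i})"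
      if "\<sigma> \<in> field_auts (adjoin T)" "i \<in> {1..r}" for \<sigma> i
      unfolding lam_image[OF that(2)] using irred[OF that(2)]
      by (intro field_aut_permutes_roots that) auto
    have coeff_mem: "Polynomial.coeff (N_poly mbar \<rho> lam \<eta> B i) k \<in> adjoin T" for k
      by (intro N_poly_invariant(1)[OF subring_endomorphism_id] lam_mem B_mem B_degree lam_inj i)
         (auto simp: bij_betw_def)
    show ?thesis
      unfolding Mbar
    proof (rule poly_mat_entry_fixed[OF coeff_mem])
      fix \<sigma> assume \<sigma>: "\<sigma> \<in> field_auts (adjoin T)"
      have "map_poly \<sigma> mbar = mbar" unfolding mbar by (rule map_poly_field_aut_base[OF \<sigma>])
      then show "map_poly \<sigma> (N_poly mbar \<rho> lam \<eta> B i) = N_poly mbar \<rho> lam \<eta> B i"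
        by (intro N_poly_invariant(2)[OF subring_endomorphism_field_aut[OF \<sigma>]]
            lam_mem B_mem B_degree bij[OF \<sigma>] lam_inj i)
    qed
  qed
  have zero_block: "r' = r \<and> invertible Mbar \<or>
      r' = r - 1 \<and> 1 \<le> r \<and> 1 \<le> \<rho> r \<and> (\<forall>j\<in>{1..\<rho> r}. lam r j = 0)"
    and nonzero_roots: "\<And>l j. l \<in> {1..r'} \<Longrightarrow> j \<in> {1..\<rho> l} \<Longrightarrow> lam l j \<noteq> 0"
  proof -
    show "r' = r \<and> invertible Mbar \<or>
      r' = r - 1 \<and> 1 \<le> r \<and> 1 \<le> \<rho> r \<and> (\<forall>j\<in>{1..\<rho> r}. lam r j = 0)"
    proof (cases "invertible M")
      case True
      then show ?thesis using r' invertible_map_matrix[OF True] by (simp add: Mbar)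
    next
      case False
      then have p_r: "p r = [:0, 1:]" by (intro X_last eigenvalue_0_if_not_invertible)
      have "r \<noteq> 0"
      proof
        assume "r = 0"
        then have one_eq_0: "mat 1 = (0 :: 'k^'n^'n)"
          using min_poly factorization by (simp add: is_min_poly_def)
        have "(mat 1 :: 'k^'n^'n) $ i $ i = 0" for i by (simp add: one_eq_0)
        then show False by (simp add: mat_def)
      qed
      then have "lam r ` {1..\<rho> r} = {x \<in> adjoin T. x = 0}"
        using lam_image[of r] by (simp add: p_r map_poly_pCons)
      also have "\<dots> = {0}" using adjoin_base[of 0 T] by auto
      finally have "lam r ` {1..\<rho> r} = {0}" .
      then have "{1..\<rho> r} \<noteq> {}" "\<forall>j\<in>{1..\<rho> r}. lam r j = 0" by (auto simp del: atLeastatMost_empty_iff2)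
      with False r' \<open>r \<noteq> 0\<close> show ?thesis by auto
    qed
    show "lam l j \<noteq> 0" if l: "l \<in> {1..r'}" and j: "j \<in> {1..\<rho> l}" for l j
    proof
      assume "lam l j = 0"
      have l_r: "l \<in> {1..r}" using l r' by (auto split: if_splits)
      then have p_l: "p l = [:0, 1:]" using lam_zero j \<open>lam l j = 0\<close> by blast
      show False
      proof (cases "invertible M")
        case True
        then show False using X_not_dvd_min_poly[OF min_poly] p_dvd[OF l_r] p_l by simp
      next
        case False
        then have "p r = [:0, 1:]" by (intro X_last eigenvalue_0_if_not_invertible)
        with p_l have "l = r"
          using distinct_factors l_r by (metis atLeastAtMost_iff inj_onD order.trans order_refl)
        with l r' False show False by auto
      qed
    qed
  qed
  show ?thesis
    unfolding F_eq
  proof (intro conjI ballI allI)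
    show "poly_mat (N_poly mbar \<rho> lam \<eta> B i) Mbar $ a $ b \<in> fixed_field (adjoin T)"
      if "i \<in> {1..r}" for i a b
      using that by (rule entries)
  qed (rule N_poly_characterization[OF annih nonzero_roots zero_block])
qed

end
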